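(* In the radial model problem described in the context (in particular assuming $\gamma k_0\rho_0^{\gamma-1}<v_0^2$, $v_a<c_*$ and $k_0<k_a<\frac1\gamma(\frac a{M_0})^{\gamma-1}c_*^{\gamma+1}$), the curves $r\mapsto H^{sup}(k_0,r)$ and $r\mapsto H^{sub}(k_a,r)$ cross at some $r=r_s$ with $a<r_s<R$ if and only if $$c_*^2>V^{sub}(k_a,R)\,V^{sup}(k_0,R)\qquad\text{and}\qquad c_*^2<V^{sup}(k_0,a)\,V^{sub}(k_a,a).$$ Moreover, when they cross at $r_s$, the flow given by $v=-V^{sup}(k_0,r)$, $\rho=M_0/(rV^{sup}(k_0,r))$, $p=k_0\rho^\gamma$ for $r_s<r\le R$ and $v=-V^{sub}(k_a,r)$, $\rho=M_0/(rV^{sub}(k_a,r))$, $p=k_a\rho^\gamma$ for $a\le r<r_s$ satisfies the radial Euler system $$(r\rho v)_r=0,\qquad (r\rho v^2+rp)_r=p,\qquad \Big(r\rho v\big(\tfrac12v^2+\iota\big)\Big)_r=0$$ on each side of $r_s$, and all the Rankine–Hugoniot conditions at $r=r_s$: $\rho v$, $\rho v^2+p$ and $\frac12v^2+\iota$ are continuous across $r=r_s$, where $\iota=\frac{\gamma}{\gamma-1}\frac p\rho$.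
   Context: Data: $\gamma>1$, $0<a<R$, and $v_0,v_a,\rho_0,k_0>0$. The boundary conditions are $v=-v_0$, $\rho=\rho_0$, $k=k_0$ at $r=R$ and $v=-v_a$ at $r=a$ for a radial gas flow with velocity $v(r)$ (positive outward), density $\rho(r)$ and pressure $p=k\rho^\gamma$. Define $M_0=\rho_0v_0R$, $\hat q_0^2=v_0^2+\frac{2\gamma}{\gamma-1}k_0\rho_0^{\gamma-1}$, $c_*^2=\frac{\gamma-1}{\gamma+1}\hat q_0^2$ with $c_*,\hat q_0>0$, and $k_a=\frac{\gamma-1}{2\gamma}\big(\frac{av_a}{M_0}\big)^{\gamma-1}(\hat q_0^2-v_a^2)$. For $a\le r\le R$: $V^{sup}(k_0,r)$ is the unique $V\in(c_*,\hat q_0)$ with $k_0=\frac{\gamma-1}{2\gamma}\big(\frac{rV}{M_0}\big)^{\gamma-1}(\hat q_0^2-V^2)$, and $V^{sub}(k_a,r)$ is the unique $V\in(0,c_* )$ with $k_a=\frac{\gamma-1}{2\gamma}\big(\frac{rV}{M_0}\big)^{\gamma-1}(\hat q_0^2-V^2)$. Define $$H^{sup}(k_0,r)=\frac{M_0(\gamma+1)}{2\gamma}\Big(\frac{c_*^2}{V^{sup}(k_0,r)}+V^{sup}(k_0,r)\Big),\qquad H^{sub}(k_a,r)=\frac{M_0(\gamma+1)}{2\gamma}\Big(\frac{c_*^2}{V^{sub}(k_a,r)}+V^{sub}(k_a,r)\Big).$$ The two curves cross at $r_s$ if $H^{sup}(k_0,r_s)=H^{sub}(k_a,r_s)$. 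*)

theory Defs
  imports Complex_Main
begin

text \<open>
  \<open>entropy_coeff \<gamma> M q r V\<close> is the constant \<open>k\<close> in \<open>p = k \<rho>\<^sup>\<gamma>\<close> for a radial flow with mass flux
  \<open>r \<rho> V = M\<close> and Bernoulli constant \<open>V\<^sup>2/2 + \<gamma>/(\<gamma>-1) p/\<rho> = q\<^sup>2/2\<close>.
  The parameter \<open>V\<close> is the speed; the velocity of the (inward) flow is \<open>-V\<close>.
\<close>

definition entropy_coeff :: "real \<Rightarrow> real \<Rightarrow> real \<Rightarrow> real \<Rightarrow> real \<Rightarrow> real" where
  "entropy_coeff \<gamma> M q r V =
     (\<gamma> - 1) / (2 * \<gamma>) * (r * V / M) powr (\<gamma> - 1) * (q\<^sup>2 - V\<^sup>2)"

definition Vsup :: "real \<Rightarrow> real \<Rightarrow> real \<Rightarrow> real \<Rightarrow> real \<Rightarrow> real \<Rightarrow> real" where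
  "Vsup \<gamma> M q c k r = (THE V. c < V \<and> V < q \<and> k = entropy_coeff \<gamma> M q r V)"

definition Vsub :: "real \<Rightarrow> real \<Rightarrow> real \<Rightarrow> real \<Rightarrow> real \<Rightarrow> real \<Rightarrow> real" where
  "Vsub \<gamma> M q c k r = (THE V. 0 < V \<and> V < c \<and> k = entropy_coeff \<gamma> M q r V)"

definition Hsup :: "real \<Rightarrow> real \<Rightarrow> real \<Rightarrow> real \<Rightarrow> real \<Rightarrow> real \<Rightarrow> real" where
  "Hsup \<gamma> M q c k r =
     M * (\<gamma> + 1) / (2 * \<gamma>) * (c\<^sup>2 / Vsup \<gamma> M q c k r + Vsup \<gamma> M q c k r)"

definition Hsub :: "real \<Rightarrow> real \<Rightarrow> real \<Rightarrow> real \<Rightarrow> real \<Rightarrow> real \<Rightarrow> real" where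
  "Hsub \<gamma> M q c k r =
     M * (\<gamma> + 1) / (2 * \<gamma>) * (c\<^sup>2 / Vsub \<gamma> M q c k r + Vsub \<gamma> M q c k r)"

definition iota :: "real \<Rightarrow> (real \<Rightarrow> real) \<Rightarrow> (real \<Rightarrow> real) \<Rightarrow> real \<Rightarrow> real" where
  "iota \<gamma> \<rho> p r = \<gamma> / (\<gamma> - 1) * (p r / \<rho> r)"

text \<open>Derivatives are taken within \<open>S\<close>, hence one-sided at an endpoint belonging to \<open>S\<close>.\<close>

definition radial_Euler_on ::
  "real set \<Rightarrow> real \<Rightarrow> (real \<Rightarrow> real) \<Rightarrow> (real \<Rightarrow> real) \<Rightarrow> (real \<Rightarrow> real) \<Rightarrow> bool" where
  "radial_Euler_on S \<gamma> v \<rho> p \<longleftrightarrow>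
     (\<forall>r\<in>S.
        ((\<lambda>r. r * \<rho> r * v r) has_real_derivative 0) (at r within S) \<and>
        ((\<lambda>r. r * \<rho> r * (v r)\<^sup>2 + r * p r) has_real_derivative p r) (at r within S) \<and>
        ((\<lambda>r. r * \<rho> r * v r * ((v r)\<^sup>2 / 2 + iota \<gamma> \<rho> p r)) has_real_derivative 0)
          (at r within S))"

text \<open>The value at \<open>s\<close> itself is irrelevant: the flow is not defined on the shock.\<close>

definition continuous_across :: "real \<Rightarrow> (real \<Rightarrow> real) \<Rightarrow> bool" where
  "continuous_across s f \<longleftrightarrow>
     (\<exists>L. (f \<longlongrightarrow> L) (at_left s) \<and> (f \<longlongrightarrow> L) (at_right s))"

definition Rankine_Hugoniot_at ::
  "real \<Rightarrow> real \<Rightarrow> (real \<Rightarrow> real) \<Rightarrow> (real \<Rightarrow> real) \<Rightarrow> (real \<Rightarrow> real) \<Rightarrow> bool" where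
  "Rankine_Hugoniot_at s \<gamma> v \<rho> p \<longleftrightarrow>
     continuous_across s (\<lambda>r. \<rho> r * v r) \<and>
     continuous_across s (\<lambda>r. \<rho> r * (v r)\<^sup>2 + p r) \<and>
     continuous_across s (\<lambda>r. (v r)\<^sup>2 / 2 + iota \<gamma> \<rho> p r)"

text \<open>
  The definite descriptions in \<open>Vsup\<close> and \<open>Vsub\<close> are meaningful as long as \<open>k\<close> lies below
  the value of \<open>entropy_coeff\<close> at its maximum \<open>V = c\<close>.
\<close>

lemma entropy_coeff_at_sonic:
  assumes "\<gamma> > 1" "M > 0" "r > 0" "c > 0" and c: "c\<^sup>2 = (\<gamma> - 1) / (\<gamma> + 1) * q\<^sup>2"
  shows "entropy_coeff \<gamma> M q r c = 1 / \<gamma> * (r / M) powr (\<gamma> - 1) * c powr (\<gamma> + 1)"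
proof -
  have q: "q\<^sup>2 - c\<^sup>2 = 2 / (\<gamma> - 1) * c\<^sup>2"
    using assms by (simp add: field_simps)
  have p: "c powr (\<gamma> + 1) = c powr (\<gamma> - 1) * c\<^sup>2"
    using \<open>c > 0\<close> powr_add[of c "\<gamma> - 1" 2] by (simp add: add.commute)
  have m: "(r * c / M) powr (\<gamma> - 1) = (r / M) powr (\<gamma> - 1) * c powr (\<gamma> - 1)"
    using assms powr_mult[of "r / M" c "\<gamma> - 1"] by (simp add: field_simps)
  show ?thesis
    unfolding entropy_coeff_def q p m using assms(1) by (simp add: field_simps)
qed

lemma entropy_coeff_deriv:
  assumes "\<gamma> > 1" "M > 0" "r > 0" "V > 0" and c: "c\<^sup>2 = (\<gamma> - 1) / (\<gamma> + 1) * q\<^sup>2"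
  shows "(entropy_coeff \<gamma> M q r has_real_derivative
     (\<gamma> - 1) / (2 * \<gamma>) * (r * V / M) powr (\<gamma> - 1) * ((\<gamma> + 1) * (c\<^sup>2 - V\<^sup>2) / V)) (at V)"
proof -
  have q: "(\<gamma> - 1) * q\<^sup>2 = (\<gamma> + 1) * c\<^sup>2" using assms by (simp add: field_simps)
  have pos: "r * V / M > 0" using assms by simp
  have "((\<lambda>V. (r * V / M) powr (\<gamma> - 1)) has_real_derivative
     (\<gamma> - 1) * (r * V / M) powr (\<gamma> - 1 - 1) * (r / M)) (at V)"
    by (rule DERIV_chain2[where f = "\<lambda>x. x powr (\<gamma> - 1)" and g = "\<lambda>V. r * V / M",
          OF has_real_derivative_powr[OF pos]])
       (use assms in \<open>auto intro!: derivative_eq_intros\<close>)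
  moreover have "(\<gamma> - 1) * (r * V / M) powr (\<gamma> - 1 - 1) * (r / M)
      = (\<gamma> - 1) * (r * V / M) powr (\<gamma> - 1) / V"
    unfolding powr_diff[of "r * V / M" "\<gamma> - 1" 1] using assms(2-4) by simp
  ultimately have P: "((\<lambda>V. (r * V / M) powr (\<gamma> - 1)) has_real_derivative
     (\<gamma> - 1) * (r * V / M) powr (\<gamma> - 1) / V) (at V)"
    by simp
  have D: "((\<lambda>V. (\<gamma> - 1) / (2 * \<gamma>) * ((r * V / M) powr (\<gamma> - 1) * (q\<^sup>2 - V\<^sup>2))) has_real_derivative
     (\<gamma> - 1) / (2 * \<gamma>) * ((\<gamma> - 1) * (r * V / M) powr (\<gamma> - 1) / V * (q\<^sup>2 - V\<^sup>2)
        - (r * V / M) powr (\<gamma> - 1) * (2 * V))) (at V)"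
    by (rule DERIV_cmult, rule DERIV_cong[OF DERIV_mult[OF P]])
       (auto intro!: derivative_eq_intros)
  have Q: "(\<gamma> - 1) * P / V * (q\<^sup>2 - V\<^sup>2) - P * (2 * V)
      = P * ((\<gamma> + 1) * (c\<^sup>2 - V\<^sup>2) / V)" for P
  proof -
    have "(\<gamma> - 1) * P / V * (q\<^sup>2 - V\<^sup>2) - P * (2 * V)
        = P * ((\<gamma> - 1) * q\<^sup>2 - (\<gamma> + 1) * V\<^sup>2) / V"
      using \<open>V > 0\<close> by (simp add: field_simps power2_eq_square)
    then show ?thesis unfolding q by (simp add: algebra_simps)
  qed
  show ?thesis
    unfolding entropy_coeff_def[abs_def] using D unfolding Q mult.assoc .
qed

lemma continuous_on_entropy_coeff:
  assumes "\<gamma> > 1" "M > 0" "r > 0"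
  shows "continuous_on {0..} (entropy_coeff \<gamma> M q r)"
  unfolding entropy_coeff_def[abs_def]
  using assms by (intro continuous_intros continuous_on_powr') auto

lemma Vsup_ex1:
  assumes "\<gamma> > 1" "M > 0" "r > 0" "c > 0" "q > 0"
    and c: "c\<^sup>2 = (\<gamma> - 1) / (\<gamma> + 1) * q\<^sup>2"
    and k: "0 < k" "k < 1 / \<gamma> * (r / M) powr (\<gamma> - 1) * c powr (\<gamma> + 1)"
  shows "\<exists>!V. c < V \<and> V < q \<and> k = entropy_coeff \<gamma> M q r V"
proof -
  let ?f = "entropy_coeff \<gamma> M q r"
  have dec: "?f y < ?f x" if "c \<le> x" "x < y" for x y
  proof (rule DERIV_neg_imp_decreasing_open[OF that(2)])
    show "continuous_on {x..y} ?f"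
      by (rule continuous_on_subset[OF continuous_on_entropy_coeff]) (use assms that in auto)
    fix V assume V: "x < V" "V < y"
    have "V > 0" "c\<^sup>2 < V\<^sup>2" using assms(4) that V by (auto intro!: power_strict_mono)
    have "(\<gamma> - 1) / (2 * \<gamma>) * (r * V / M) powr (\<gamma> - 1) > 0"
      using assms(1-3) \<open>V > 0\<close> by simp
    moreover have "(\<gamma> + 1) * (c\<^sup>2 - V\<^sup>2) / V < 0"
      using assms(1) \<open>V > 0\<close> \<open>c\<^sup>2 < V\<^sup>2\<close> by (simp add: mult_pos_neg divide_neg_pos)
    ultimately show "\<exists>d. (?f has_real_derivative d) (at V) \<and> d < 0"
      using entropy_coeff_deriv[OF assms(1-3) \<open>V > 0\<close> c]
      by (blast intro: mult_pos_neg)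
  qed
  have fc: "k < ?f c" using entropy_coeff_at_sonic[OF assms(1-4) c] k by simp
  have fq: "?f q = 0" by (simp add: entropy_coeff_def)
  have cont: "continuous_on {c..q} ?f"
    by (rule continuous_on_subset[OF continuous_on_entropy_coeff[OF assms(1-3)]])
       (use \<open>c > 0\<close> in auto)
  have "(\<gamma> - 1) / (\<gamma> + 1) * q\<^sup>2 < 1 * q\<^sup>2"
    using assms(1,5) by (intro mult_strict_right_mono) simp_all
  then have "c\<^sup>2 < q\<^sup>2" unfolding c by (simp only: mult_1_left)
  then have "c \<le> q"
    using assms(5) power_less_imp_less_base[of c 2 q] by simp
  then obtain V where V: "c \<le> V" "V \<le> q" "?f V = k"
    using IVT2'[of ?f q k c, OF _ _ _ cont] fc fq k(1) by auto
  have "V \<noteq> c" "V \<noteq> q"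
    using V(3) k(1) fc fq by auto
  with V have V': "c < V \<and> V < q \<and> k = ?f V"
    by simp
  show ?thesis
  proof (rule ex1I[of _ V])
    fix W assume W: "c < W \<and> W < q \<and> k = ?f W"
    show "W = V"
    proof (rule ccontr)
      assume "W \<noteq> V"
      then consider "W < V" | "V < W" by linarith
      then show False
      proof cases
        case 1
        then show False using dec[of W V] V' W by simp
      next
        case 2
        then show False using dec[of V W] V' W by simp
      qed
    qed
  qed (rule V')
qed

lemma Vsub_ex1:
  assumes "\<gamma> > 1" "M > 0" "r > 0" "c > 0" "q > 0"
    and c: "c\<^sup>2 = (\<gamma> - 1) / (\<gamma> + 1) * q\<^sup>2"
    and k: "0 < k" "k < 1 / \<gamma> * (r / M) powr (\<gamma> - 1) * c powr (\<gamma> + 1)"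
  shows "\<exists>!V. 0 < V \<and> V < c \<and> k = entropy_coeff \<gamma> M q r V"
proof -
  let ?f = "entropy_coeff \<gamma> M q r"
  have inc: "?f x < ?f y" if "0 \<le> x" "x < y" "y \<le> c" for x y
  proof (rule DERIV_pos_imp_increasing_open[OF that(2)])
    show "continuous_on {x..y} ?f"
      by (rule continuous_on_subset[OF continuous_on_entropy_coeff]) (use assms that in auto)
    fix V assume V: "x < V" "V < y"
    have "V > 0" "V\<^sup>2 < c\<^sup>2" using assms(4) that V by (auto intro!: power_strict_mono)
    have "(\<gamma> - 1) / (2 * \<gamma>) * (r * V / M) powr (\<gamma> - 1) > 0"
      using assms(1-3) \<open>V > 0\<close> by simp
    moreover have "(\<gamma> + 1) * (c\<^sup>2 - V\<^sup>2) / V > 0"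
      using assms(1) \<open>V > 0\<close> \<open>V\<^sup>2 < c\<^sup>2\<close> by (simp add: zero_less_mult_iff)
    ultimately show "\<exists>d. (?f has_real_derivative d) (at V) \<and> d > 0"
      using entropy_coeff_deriv[OF assms(1-3) \<open>V > 0\<close> c]
      by (blast intro: mult_pos_pos)
  qed
  have fc: "k < ?f c" using entropy_coeff_at_sonic[OF assms(1-4) c] k by simp
  have f0: "?f 0 = 0" by (simp add: entropy_coeff_def)
  have cont: "continuous_on {0..c} ?f"
    by (rule continuous_on_subset[OF continuous_on_entropy_coeff[OF assms(1-3)]])
       (use \<open>c > 0\<close> in auto)
  obtain V where V: "0 \<le> V" "V \<le> c" "?f V = k"
    using IVT'[of ?f 0 k c, OF _ _ _ cont] fc f0 k(1) \<open>c > 0\<close> by auto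
  have "V \<noteq> 0" "V \<noteq> c"
    using V(3) k(1) fc f0 by auto
  with V have V': "0 < V \<and> V < c \<and> k = ?f V"
    by simp
  show ?thesis
  proof (rule ex1I[of _ V])
    fix W assume W: "0 < W \<and> W < c \<and> k = ?f W"
    show "W = V"
    proof (rule ccontr)
      assume "W \<noteq> V"
      then consider "W < V" | "V < W" by linarith
      then show False
      proof cases
        case 1
        then show False using inc[of W V] V' W by simp
      next
        case 2
        then show False using inc[of V W] V' W by simp
      qed
    qed
  qed (rule V')
qed

end

theory Submission
  imports Defs "HOL-Complex_Analysis.Conformal_Mappings"
begin

text \<open>
  For fixed entropy \<open>k\<close>, mass flux \<open>M\<close> and Bernoulli constant \<open>q\<^sup>2/2\<close> the radius is an explicit
  function of the speed; its logarithm is \<open>log_radius k V\<close>. This function decreases on \<open>(0, c)\<close> and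
  increases on \<open>(c, q)\<close>, and \<open>Vsub\<close> and \<open>Vsup\<close> are the inverses of its two branches. Their
  monotonicity and differentiability in \<open>r\<close> therefore follow from the derivative of \<open>log_radius\<close>.

  Two speeds \<open>U > c > W\<close> give equal \<open>H\<close> exactly if \<open>U W = c\<^sup>2\<close> (Prandtl's relation), so the curves
  cross where \<open>Vsub = c\<^sup>2 / Vsup\<close>. In the product \<open>Vsup Vsub\<close> an increasing and a decreasing
  factor compete. To avoid this, \<open>c\<^sup>2 / U\<close> is compared with \<open>Vsub\<close> through the radii at which the
  two speeds occur: with \<open>U = Vsup k r\<close>, the sign of
  \<open>U Vsub - c\<^sup>2\<close> is the sign of \<open>shock_gap k k' U = log_radius k' (c\<^sup>2 / U) - log_radius k U\<close>
  (\<open>Vsub_vs_shock_gap\<close>). The latter depends on \<open>r\<close> only through \<open>U\<close>. Up to a constant and a negative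
  factor it is the logarithm of the entropy ratio across a normal shock with upstream speed \<open>U\<close>,
  and since stronger shocks produce more entropy it is strictly decreasing
  (\<open>shock_gap_strict_antimono\<close>). As \<open>Vsup\<close> increases with \<open>r\<close>, a zero strictly inside \<open>(a, R)\<close>
  exists if and only if the signs at \<open>a\<close> and \<open>R\<close> are positive and negative (\<open>crossing_iff\<close>).

  For the flow, constancy of the entropy coefficient is Bernoulli's law, and \<open>H\<close> is the momentum
  flux \<open>r (\<rho> v\<^sup>2 + p)\<close> (\<open>flow_quantities\<close>). The mass and energy equations are then immediate, the
  momentum equation is the computation of \<open>H'\<close> from the derivative of the branch, and the jump
  conditions reduce to the equality of the two values of \<open>H\<close> at the shock.
\<close>

section \<open>Radius as a function of speed\<close>

locale radial_gas =
  fixes \<gamma> M q c :: real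
  assumes gamma: "\<gamma> > 1" and M_pos: "M > 0" and q_pos: "q > 0" and c_pos: "c > 0"
    and sonic: "c\<^sup>2 = (\<gamma> - 1) / (\<gamma> + 1) * q\<^sup>2"
begin

lemma bernoulli_sonic: "(\<gamma> - 1) * q\<^sup>2 = (\<gamma> + 1) * c\<^sup>2"
  using sonic gamma by (simp add: field_simps)

lemma c_less_q: "c < q"
proof -
  have "(\<gamma> - 1) / (\<gamma> + 1) * q\<^sup>2 < 1 * q\<^sup>2"
    using gamma q_pos by (intro mult_strict_right_mono) simp_all
  then have "c\<^sup>2 < q\<^sup>2" unfolding sonic by (simp only: mult_1_left)
  then show ?thesis using q_pos power_less_imp_less_base[of c 2 q] by simp
qed

text \<open>Solving \<open>k = entropy_coeff \<gamma> M q r V\<close> for \<open>ln r\<close>.\<close>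

definition log_radius :: "real \<Rightarrow> real \<Rightarrow> real" where
  "log_radius k V = ln M - ln V + (ln (2 * \<gamma> * k / (\<gamma> - 1)) - ln (q\<^sup>2 - V\<^sup>2)) / (\<gamma> - 1)"

lemma speed_gap_pos: "0 < q\<^sup>2 - V\<^sup>2" if "0 < V" "V < q"
  using power_strict_mono[of V q 2] that by simp

lemma entropy_coeff_eq_iff:
  assumes V: "0 < V" "V < q" and k: "k > 0" and r: "r > 0"
  shows "k = entropy_coeff \<gamma> M q r V \<longleftrightarrow> ln r = log_radius k V"
proof -
  note gap = speed_gap_pos[OF V]
  have pos: "entropy_coeff \<gamma> M q r V > 0"
    unfolding entropy_coeff_def using gamma M_pos r V gap by simp
  have "ln (entropy_coeff \<gamma> M q r V)
      = ln ((\<gamma> - 1) / (2 * \<gamma>)) + ln ((r * V / M) powr (\<gamma> - 1)) + ln (q\<^sup>2 - V\<^sup>2)"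
    unfolding entropy_coeff_def using gamma M_pos r V gap
    by (subst ln_mult_pos ln_mult_pos, simp, simp)+ simp
  also have "ln ((r * V / M) powr (\<gamma> - 1)) = (\<gamma> - 1) * ln (r * V / M)"
    by (simp add: ln_powr)
  also have "ln (r * V / M) = ln r + ln V - ln M"
    using M_pos r V by (simp add: ln_mult_pos ln_div)
  finally have e: "ln (entropy_coeff \<gamma> M q r V)
      = ln ((\<gamma> - 1) / (2 * \<gamma>)) + (\<gamma> - 1) * (ln r + ln V - ln M) + ln (q\<^sup>2 - V\<^sup>2)" .
  have "ln (2 * \<gamma> * k / (\<gamma> - 1)) = ln (k / ((\<gamma> - 1) / (2 * \<gamma>)))"
    using gamma by (simp add: field_simps)
  also have "\<dots> = ln k - ln ((\<gamma> - 1) / (2 * \<gamma>))"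
    using gamma k by (intro ln_divide_pos) simp_all
  finally have l: "ln (2 * \<gamma> * k / (\<gamma> - 1)) = ln k - ln ((\<gamma> - 1) / (2 * \<gamma>))" .
  have "k = entropy_coeff \<gamma> M q r V \<longleftrightarrow> ln k = ln (entropy_coeff \<gamma> M q r V)"
    using k pos by simp
  then show ?thesis
    unfolding e log_radius_def l using gamma by (simp add: field_simps) argo
qed

lemma log_radius_deriv:
  assumes V: "0 < V" "V < q"
  shows "(log_radius k has_real_derivative
           (\<gamma> + 1) * (V\<^sup>2 - c\<^sup>2) / ((\<gamma> - 1) * V * (q\<^sup>2 - V\<^sup>2))) (at V)"
proof -
  note gap = speed_gap_pos[OF V]
  have "(log_radius k has_real_derivative
          (- (1 / V) + (2 * V / (q\<^sup>2 - V\<^sup>2)) / (\<gamma> - 1))) (at V)"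
    unfolding log_radius_def[abs_def] using gamma V gap
    by (auto intro!: derivative_eq_intros)
  moreover have "- (1 / V) + (2 * V / (q\<^sup>2 - V\<^sup>2)) / (\<gamma> - 1)
      = (2 * V\<^sup>2 - (\<gamma> - 1) * (q\<^sup>2 - V\<^sup>2)) / ((\<gamma> - 1) * V * (q\<^sup>2 - V\<^sup>2))"
    using gamma V gap by (simp add: divide_simps power2_eq_square)
  moreover have "2 * V\<^sup>2 - (\<gamma> - 1) * (q\<^sup>2 - V\<^sup>2) = (\<gamma> + 1) * (V\<^sup>2 - c\<^sup>2)"
    using bernoulli_sonic by (simp add: algebra_simps)
  ultimately show ?thesis by simp
qed

lemma log_radius_strict_mono:
  assumes "c \<le> x" "x < y" "y < q"
  shows "log_radius k x < log_radius k y"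
proof (rule DERIV_pos_imp_increasing_open[OF assms(2)])
  fix V assume "x < V" "V < y"
  then have V: "0 < V" "V < q" "c\<^sup>2 < V\<^sup>2"
    using assms c_pos by (auto intro!: power_strict_mono)
  then show "\<exists>d. (log_radius k has_real_derivative d) (at V) \<and> 0 < d"
    using log_radius_deriv[OF V(1,2)] speed_gap_pos[OF V(1,2)] gamma
    by (intro exI conjI) (assumption, simp)
next
  show "continuous_on {x..y} (log_radius k)"
    by (rule DERIV_atLeastAtMost_imp_continuous_on)
       (use assms c_pos in \<open>auto intro!: exI log_radius_deriv\<close>)
qed

lemma log_radius_strict_antimono:
  assumes "0 < x" "x < y" "y \<le> c"
  shows "log_radius k y < log_radius k x"
proof (rule DERIV_neg_imp_decreasing_open[OF assms(2)])
  fix V assume "x < V" "V < y"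
  then have V: "0 < V" "V < q" "V\<^sup>2 < c\<^sup>2"
    using assms c_less_q by (auto intro!: power_strict_mono)
  then show "\<exists>d. (log_radius k has_real_derivative d) (at V) \<and> d < 0"
    using log_radius_deriv[OF V(1,2)] speed_gap_pos[OF V(1,2)] gamma
    by (intro exI conjI) (assumption, simp add: divide_neg_pos mult_pos_neg)
next
  show "continuous_on {x..y} (log_radius k)"
    by (rule DERIV_atLeastAtMost_imp_continuous_on)
       (use assms c_less_q in \<open>auto intro!: exI log_radius_deriv\<close>)
qed

section \<open>The two branches\<close>

text \<open>
  Uniqueness comes from the strict monotonicity of \<open>log_radius\<close>. This is the left-inverse property
  \<open>Vsup k (exp (log_radius k V)) = V\<close> on which the inverse function theorem is used below.
\<close>

lemma Vsup_eqI:
  assumes "c < V" "V < q" "k > 0" "r > 0" "ln r = log_radius k V"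
  shows "Vsup \<gamma> M q c k r = V"
  unfolding Vsup_def
proof (rule the_equality)
  show "c < V \<and> V < q \<and> k = entropy_coeff \<gamma> M q r V"
    using assms c_pos by (simp add: entropy_coeff_eq_iff)
  fix W assume "c < W \<and> W < q \<and> k = entropy_coeff \<gamma> M q r W"
  then have W: "c < W" "W < q" "log_radius k W = log_radius k V"
    using assms c_pos entropy_coeff_eq_iff[of W k r] by simp_all
  then show "W = V"
    using assms(1,2) log_radius_strict_mono[of W V k] log_radius_strict_mono[of V W k]
    by linarith
qed

lemma Vsub_eqI:
  assumes "0 < V" "V < c" "k > 0" "r > 0" "ln r = log_radius k V"
  shows "Vsub \<gamma> M q c k r = V"
  unfolding Vsub_def
proof (rule the_equality)
  show "0 < V \<and> V < c \<and> k = entropy_coeff \<gamma> M q r V"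
    using assms c_less_q by (simp add: entropy_coeff_eq_iff)
  fix W assume "0 < W \<and> W < c \<and> k = entropy_coeff \<gamma> M q r W"
  then have W: "0 < W" "W < c" "log_radius k W = log_radius k V"
    using assms c_less_q entropy_coeff_eq_iff[of W k r] by simp_all
  then show "W = V"
    using assms(1,2) log_radius_strict_antimono[of W V k] log_radius_strict_antimono[of V W k]
    by linarith
qed

lemma Vsup_branch:
  assumes "r > 0" "k > 0" "k < 1 / \<gamma> * (r / M) powr (\<gamma> - 1) * c powr (\<gamma> + 1)"
  shows "c < Vsup \<gamma> M q c k r" "Vsup \<gamma> M q c k r < q"
    "ln r = log_radius k (Vsup \<gamma> M q c k r)"
  using theI'[OF Vsup_ex1[OF gamma M_pos assms(1) c_pos q_pos sonic assms(2,3)]]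
    assms c_pos entropy_coeff_eq_iff[of "Vsup \<gamma> M q c k r" k r]
  by (simp_all flip: Vsup_def)

lemma Vsub_branch:
  assumes "r > 0" "k > 0" "k < 1 / \<gamma> * (r / M) powr (\<gamma> - 1) * c powr (\<gamma> + 1)"
  shows "0 < Vsub \<gamma> M q c k r" "Vsub \<gamma> M q c k r < c"
    "ln r = log_radius k (Vsub \<gamma> M q c k r)"
  using theI'[OF Vsub_ex1[OF gamma M_pos assms(1) c_pos q_pos sonic assms(2,3)]]
    assms c_less_q entropy_coeff_eq_iff[of "Vsub \<gamma> M q c k r" k r]
  by (simp_all flip: Vsub_def)

text \<open>
  Either branch is a left inverse of \<open>exp \<circ> log_radius k\<close> on an open set of speeds, so the inverse
  function theorem gives its derivative. The formula degenerates only at the sonic speed.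
\<close>

lemma branch_deriv:
  assumes S: "open S" "S \<subseteq> {0<..<q}" and V: "V \<in> S" "V \<noteq> c"
    and inv: "\<And>z. z \<in> S \<Longrightarrow> g (exp (log_radius k z)) = z"
    and r: "r > 0" "ln r = log_radius k V"
  shows "(g has_real_derivative
           (\<gamma> - 1) * V * (q\<^sup>2 - V\<^sup>2) / ((\<gamma> + 1) * (V\<^sup>2 - c\<^sup>2) * r)) (at r)"
proof -
  let ?f = "\<lambda>z. exp (log_radius k z)"
  have f: "(?f has_real_derivative
      ?f z * ((\<gamma> + 1) * (z\<^sup>2 - c\<^sup>2) / ((\<gamma> - 1) * z * (q\<^sup>2 - z\<^sup>2)))) (at z)"
    if "z \<in> S" for z
    using DERIV_fun_exp[OF log_radius_deriv] S(2) that by auto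
  have rV: "?f V = r" using r by (metis exp_ln)
  have V': "0 < V" "V < q" using S(2) V(1) by auto
  have "V\<^sup>2 \<noteq> c\<^sup>2" using V(2) V' c_pos by (simp add: power2_eq_iff)
  then have nz: "r * ((\<gamma> + 1) * (V\<^sup>2 - c\<^sup>2) / ((\<gamma> - 1) * V * (q\<^sup>2 - V\<^sup>2))) \<noteq> 0"
    using speed_gap_pos[OF V'] r gamma V' by simp
  have "continuous_on S ?f"
    using f by (intro continuous_at_imp_continuous_on ballI) (rule DERIV_isCont)
  moreover have "(?f has_real_derivative
      r * ((\<gamma> + 1) * (V\<^sup>2 - c\<^sup>2) / ((\<gamma> - 1) * V * (q\<^sup>2 - V\<^sup>2)))) (at V)"
    using f[OF V(1)] unfolding rV .
  ultimately have "(g has_real_derivative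
      inverse (r * ((\<gamma> + 1) * (V\<^sup>2 - c\<^sup>2) / ((\<gamma> - 1) * V * (q\<^sup>2 - V\<^sup>2))))) (at (?f V))"
    using has_field_derivative_inverse_strong[of ?f _ V S g] nz S(1) V(1) inv by blast
  then show ?thesis unfolding rV by (simp add: mult_ac)
qed

lemma Vsup_deriv:
  fixes k r :: real
  defines "V \<equiv> Vsup \<gamma> M q c k r"
  assumes "r > 0" "k > 0" "k < 1 / \<gamma> * (r / M) powr (\<gamma> - 1) * c powr (\<gamma> + 1)"
  shows "(Vsup \<gamma> M q c k has_real_derivative
           (\<gamma> - 1) * V * (q\<^sup>2 - V\<^sup>2) / ((\<gamma> + 1) * (V\<^sup>2 - c\<^sup>2) * r)) (at r)"
  unfolding V_def
  by (rule branch_deriv[where S = "{c<..<q}"])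
     (use assms(2-) Vsup_branch[OF assms(2-)] c_pos in \<open>auto intro!: Vsup_eqI\<close>)

lemma Vsub_deriv:
  fixes k r :: real
  defines "V \<equiv> Vsub \<gamma> M q c k r"
  assumes "r > 0" "k > 0" "k < 1 / \<gamma> * (r / M) powr (\<gamma> - 1) * c powr (\<gamma> + 1)"
  shows "(Vsub \<gamma> M q c k has_real_derivative
           (\<gamma> - 1) * V * (q\<^sup>2 - V\<^sup>2) / ((\<gamma> + 1) * (V\<^sup>2 - c\<^sup>2) * r)) (at r)"
  unfolding V_def
  by (rule branch_deriv[where S = "{0<..<c}"])
     (use assms(2-) Vsub_branch[OF assms(2-)] c_less_q in \<open>auto intro!: Vsub_eqI\<close>)

lemma Vsup_less_iff:
  assumes "c \<le> W" "W < q" "r > 0" "k > 0"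
    and "k < 1 / \<gamma> * (r / M) powr (\<gamma> - 1) * c powr (\<gamma> + 1)"
  shows "Vsup \<gamma> M q c k r < W \<longleftrightarrow> ln r < log_radius k W"
  using Vsup_branch[OF assms(3-)] assms(1,2)
    log_radius_strict_mono[of "Vsup \<gamma> M q c k r" W k]
    log_radius_strict_mono[of W "Vsup \<gamma> M q c k r" k]
  by (cases W "Vsup \<gamma> M q c k r" rule: linorder_cases) auto

lemma less_Vsub_iff:
  assumes "0 < W" "W \<le> c" "r > 0" "k > 0"
    and "k < 1 / \<gamma> * (r / M) powr (\<gamma> - 1) * c powr (\<gamma> + 1)"
  shows "W < Vsub \<gamma> M q c k r \<longleftrightarrow> ln r < log_radius k W"
  using Vsub_branch[OF assms(3-)] assms(1,2)
    log_radius_strict_antimono[of "Vsub \<gamma> M q c k r" W k]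
    log_radius_strict_antimono[of W "Vsub \<gamma> M q c k r" k]
  by (cases W "Vsub \<gamma> M q c k r" rule: linorder_cases) auto

section \<open>Comparison across a shock\<close>

text \<open>
  Logarithm of the ratio of two radii: where the \<open>k'\<close>-flow has the speed \<open>c\<^sup>2 / U\<close> behind a normal
  shock with upstream speed \<open>U\<close>, and where the \<open>k\<close>-flow has the speed \<open>U\<close>. It vanishes if the shock
  turns entropy \<open>k\<close> into entropy \<open>k'\<close>.
\<close>

definition shock_gap :: "real \<Rightarrow> real \<Rightarrow> real \<Rightarrow> real" where
  "shock_gap k k' U = log_radius k' (c\<^sup>2 / U) - log_radius k U"

lemma prandtl_speed:
  assumes "c < U" shows "0 < c\<^sup>2 / U" "c\<^sup>2 / U < c"
  using assms c_pos by (simp_all add: field_simps power2_eq_square)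

text \<open>
  The two contributions to the derivative have opposite signs. After division by the common
  positive factor and clearing of denominators, the comparison is
  \<open>c\<^sup>2 (q\<^sup>2 - U\<^sup>2) < q\<^sup>2 U\<^sup>2 - c\<^sup>4\<close>, that is
  \<open>0 < (q\<^sup>2 + c\<^sup>2) (U\<^sup>2 - c\<^sup>2)\<close>: entropy production grows with the upstream speed.
\<close>

lemma shock_gap_deriv:
  assumes U: "c < U" "U < q"
  shows "\<exists>d. (shock_gap k k' has_real_derivative d) (at U) \<and> d < 0"
proof -
  let ?W = "c\<^sup>2 / U"
  have U0: "0 < U" using U c_pos by simp
  have W: "0 < ?W" "?W < q" using prandtl_speed[OF U(1)] c_less_q by simp_all
  let ?L = "\<lambda>V. (\<gamma> + 1) * (V\<^sup>2 - c\<^sup>2) / ((\<gamma> - 1) * V * (q\<^sup>2 - V\<^sup>2))"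
  have inner: "((\<lambda>U. c\<^sup>2 / U) has_real_derivative - c\<^sup>2 / U\<^sup>2) (at U)"
    using U0 by (auto intro!: derivative_eq_intros simp: power2_eq_square)
  have D: "(shock_gap k k' has_real_derivative ?L ?W * (- c\<^sup>2 / U\<^sup>2) - ?L U) (at U)"
    unfolding shock_gap_def[abs_def]
    by (intro DERIV_diff log_radius_deriv[OF U0 U(2)]
          DERIV_chain2[where f = "log_radius k'", OF log_radius_deriv[OF W] inner])
  have gU: "0 < q\<^sup>2 - U\<^sup>2" using speed_gap_pos[OF U0 U(2)] .
  have cU: "c\<^sup>2 < U\<^sup>2" and cq: "c\<^sup>2 < q\<^sup>2"
    using U c_pos c_less_q by (auto intro!: power_strict_mono)
  have gW: "0 < q\<^sup>2 * U\<^sup>2 - c\<^sup>2 * c\<^sup>2"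
    using mult_strict_mono[OF cq cU] c_pos q_pos by simp
  have "?L ?W * (- c\<^sup>2 / U\<^sup>2) = (\<gamma> + 1) * c\<^sup>2 * (U\<^sup>2 - c\<^sup>2) / ((\<gamma> - 1) * U * (q\<^sup>2 * U\<^sup>2 - c\<^sup>2 * c\<^sup>2))"
  proof -
    have "?W\<^sup>2 - c\<^sup>2 = c\<^sup>2 * (c\<^sup>2 - U\<^sup>2) / U\<^sup>2"
      using U0 by (simp add: field_simps power2_eq_square)
    moreover have "q\<^sup>2 - ?W\<^sup>2 = (q\<^sup>2 * U\<^sup>2 - c\<^sup>2 * c\<^sup>2) / U\<^sup>2"
      using U0 by (simp add: field_simps power2_eq_square)
    ultimately show ?thesis
      using U0 c_pos gamma gW
      by (simp add: divide_simps) (simp add: algebra_simps power2_eq_square)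
  qed
  also have "\<dots> < ?L U"
  proof -
    have "c\<^sup>2 * (q\<^sup>2 - U\<^sup>2) < q\<^sup>2 * U\<^sup>2 - c\<^sup>2 * c\<^sup>2"
    proof -
      have "0 < (q\<^sup>2 + c\<^sup>2) * (U\<^sup>2 - c\<^sup>2)"
        using cU c_pos q_pos by (intro mult_pos_pos add_pos_pos) simp_all
      then show ?thesis by (simp add: algebra_simps)
    qed
    then have "c\<^sup>2 / (q\<^sup>2 * U\<^sup>2 - c\<^sup>2 * c\<^sup>2) < 1 / (q\<^sup>2 - U\<^sup>2)"
      using gU gW by (simp add: divide_simps)
    moreover have "0 < (\<gamma> + 1) * (U\<^sup>2 - c\<^sup>2) / ((\<gamma> - 1) * U)"
      using gamma cU U0 by simp
    ultimately have "(\<gamma> + 1) * (U\<^sup>2 - c\<^sup>2) / ((\<gamma> - 1) * U) * (c\<^sup>2 / (q\<^sup>2 * U\<^sup>2 - c\<^sup>2 * c\<^sup>2))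
        < (\<gamma> + 1) * (U\<^sup>2 - c\<^sup>2) / ((\<gamma> - 1) * U) * (1 / (q\<^sup>2 - U\<^sup>2))"
      by (rule mult_strict_left_mono)
    then show ?thesis by (simp add: mult_ac)
  qed
  finally show ?thesis using D by (intro exI conjI) (assumption, simp)
qed

lemma shock_gap_strict_antimono:
  assumes "c < x" "x < y" "y < q"
  shows "shock_gap k k' y < shock_gap k k' x"
  by (rule DERIV_neg_imp_decreasing[OF assms(2)], rule shock_gap_deriv) (use assms in auto)

text \<open>
  The function \<open>V \<mapsto> c\<^sup>2 / V + V\<close> is invariant under \<open>V \<mapsto> c\<^sup>2 / V\<close> and otherwise injective, and the two
  branches are distinct because they lie on different sides of \<open>c\<close>.
\<close>

lemma H_eq_iff:
  assumes "r > 0" "k > 0" "k < 1 / \<gamma> * (r / M) powr (\<gamma> - 1) * c powr (\<gamma> + 1)"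
    and "k' > 0" "k' < 1 / \<gamma> * (r / M) powr (\<gamma> - 1) * c powr (\<gamma> + 1)"
  shows "Hsup \<gamma> M q c k r = Hsub \<gamma> M q c k' r
    \<longleftrightarrow> Vsub \<gamma> M q c k' r = c\<^sup>2 / Vsup \<gamma> M q c k r"
proof -
  define U W where "U = Vsup \<gamma> M q c k r" and "W = Vsub \<gamma> M q c k' r"
  have UW: "0 < W" "W < U"
    using Vsup_branch[OF assms(1-3)] Vsub_branch[OF assms(1,4,5)] by (simp_all add: U_def W_def)
  have "M * (\<gamma> + 1) / (2 * \<gamma>) \<noteq> 0" using M_pos gamma by simp
  then have "Hsup \<gamma> M q c k r = Hsub \<gamma> M q c k' r \<longleftrightarrow> c\<^sup>2 / U + U = c\<^sup>2 / W + W"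
    unfolding Hsup_def Hsub_def U_def W_def by simp
  also have "\<dots> \<longleftrightarrow> (U - W) * (U * W - c\<^sup>2) = 0"
  proof -
    have "c\<^sup>2 / U + U - (c\<^sup>2 / W + W) = (U - W) * (U * W - c\<^sup>2) / (U * W)"
      using UW by (simp add: field_simps)
    then show ?thesis using UW by auto
  qed
  also have "\<dots> \<longleftrightarrow> W = c\<^sup>2 / U"
    using UW by (auto simp: eq_divide_eq mult.commute)
  finally show ?thesis unfolding U_def W_def .
qed

text \<open>
  The radius of the \<open>k'\<close>-flow decreases with speed on the subsonic branch, so comparing \<open>c\<^sup>2 / U\<close>
  with \<open>Vsub\<close> at \<open>r\<close> amounts to comparing \<open>log_radius k' (c\<^sup>2 / U)\<close> with \<open>ln r = log_radius k U\<close>.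
  Thereby \<open>r\<close> and \<open>Vsub\<close> are eliminated.
\<close>

lemma Vsub_vs_shock_gap:
  fixes k k' r :: real
  defines "U \<equiv> Vsup \<gamma> M q c k r" and "W \<equiv> Vsub \<gamma> M q c k' r"
  assumes "r > 0" "k > 0" "k < 1 / \<gamma> * (r / M) powr (\<gamma> - 1) * c powr (\<gamma> + 1)"
    and "k' > 0" "k' < 1 / \<gamma> * (r / M) powr (\<gamma> - 1) * c powr (\<gamma> + 1)"
  shows "c\<^sup>2 < U * W \<longleftrightarrow> shock_gap k k' U > 0"
    and "U * W < c\<^sup>2 \<longleftrightarrow> shock_gap k k' U < 0"
    and "W = c\<^sup>2 / U \<longleftrightarrow> shock_gap k k' U = 0"
proof -
  note U = Vsup_branch[OF assms(3-5), folded U_def]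
  note W = Vsub_branch[OF assms(3,6,7), folded W_def]
  note P = prandtl_speed[OF U(1)]
  have U0: "0 < U" using U c_pos by simp
  have 1: "c\<^sup>2 / U < W \<longleftrightarrow> shock_gap k k' U > 0"
    using less_Vsub_iff[of "c\<^sup>2 / U" r k'] P assms(3,6,7) U(3)
    by (simp add: shock_gap_def W_def)
  have 2: "W = c\<^sup>2 / U \<longleftrightarrow> shock_gap k k' U = 0"
  proof
    assume "W = c\<^sup>2 / U"
    then show "shock_gap k k' U = 0" using W(3) U(3) by (simp add: shock_gap_def)
  next
    assume "shock_gap k k' U = 0"
    then show "W = c\<^sup>2 / U"
      unfolding W_def using P assms(3,6) U(3) by (intro Vsub_eqI) (simp_all add: shock_gap_def)
  qed
  show "W = c\<^sup>2 / U \<longleftrightarrow> shock_gap k k' U = 0" by (fact 2)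
  show "c\<^sup>2 < U * W \<longleftrightarrow> shock_gap k k' U > 0"
    using 1 U0 by (simp add: field_simps)
  have "U * W < c\<^sup>2 \<longleftrightarrow> W < c\<^sup>2 / U" using U0 by (simp add: field_simps)
  then show "U * W < c\<^sup>2 \<longleftrightarrow> shock_gap k k' U < 0" using 1 2 by linarith
qed

lemma subsonic_bound_mono:
  assumes "0 < a" "a \<le> r" "k < 1 / \<gamma> * (a / M) powr (\<gamma> - 1) * c powr (\<gamma> + 1)"
  shows "k < 1 / \<gamma> * (r / M) powr (\<gamma> - 1) * c powr (\<gamma> + 1)"
proof -
  have "(a / M) powr (\<gamma> - 1) \<le> (r / M) powr (\<gamma> - 1)"
    using assms gamma M_pos by (intro powr_mono2) (simp_all add: divide_right_mono)
  then have "1 / \<gamma> * (a / M) powr (\<gamma> - 1) * c powr (\<gamma> + 1)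
      \<le> 1 / \<gamma> * (r / M) powr (\<gamma> - 1) * c powr (\<gamma> + 1)"
    using gamma by (intro mult_right_mono mult_left_mono) simp_all
  then show ?thesis using assms(3) by linarith
qed

text \<open>
  The whole question is about the sign of the strictly decreasing function \<open>shock_gap k k'\<close> on the
  speed interval \<open>[Vsup a, Vsup R]\<close>. Applying the intermediate value theorem in the speed variable
  and mapping the zero back to a radius by \<open>exp \<circ> log_radius k\<close> avoids continuity of the branches.
\<close>

theorem crossing_iff:
  assumes a: "0 < a" "a < R" and k: "k > 0" "k' > 0"
    and kb: "k < 1 / \<gamma> * (a / M) powr (\<gamma> - 1) * c powr (\<gamma> + 1)"
    and kb': "k' < 1 / \<gamma> * (a / M) powr (\<gamma> - 1) * c powr (\<gamma> + 1)"
  shows "(\<exists>s. a < s \<and> s < R \<and> Hsup \<gamma> M q c k s = Hsub \<gamma> M q c k' s) \<longleftrightarrow>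
      Vsup \<gamma> M q c k R * Vsub \<gamma> M q c k' R < c\<^sup>2 \<and>
      c\<^sup>2 < Vsup \<gamma> M q c k a * Vsub \<gamma> M q c k' a"
proof -
  let ?U = "Vsup \<gamma> M q c k"
  let ?D = "shock_gap k k'"
  have b: "k < 1 / \<gamma> * (r / M) powr (\<gamma> - 1) * c powr (\<gamma> + 1)"
    and b': "k' < 1 / \<gamma> * (r / M) powr (\<gamma> - 1) * c powr (\<gamma> + 1)" if "a \<le> r" for r
    using subsonic_bound_mono[OF a(1) that] kb kb' by blast+
  have U: "c < ?U r" "?U r < q" "ln r = log_radius k (?U r)" if "a \<le> r" for r
    using Vsup_branch[OF _ k(1) b[OF that]] that a by simp_all
  have mono: "?U r < ?U s" if "a \<le> r" "r < s" for r s
    using Vsup_less_iff[OF _ _ _ k(1) b[OF that(1)], of "?U s"] U[of s] that a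
      ln_less_cancel_iff[of r s] by simp
  have gap: "?D (?U r) = 0 \<longleftrightarrow> Hsup \<gamma> M q c k r = Hsub \<gamma> M q c k' r" if "a \<le> r" for r
    using H_eq_iff[OF _ k(1) b k(2) b'] Vsub_vs_shock_gap(3)[OF _ k(1) b k(2) b'] that a by simp
  have ends: "Vsup \<gamma> M q c k R * Vsub \<gamma> M q c k' R < c\<^sup>2 \<longleftrightarrow> ?D (?U R) < 0"
    "c\<^sup>2 < Vsup \<gamma> M q c k a * Vsub \<gamma> M q c k' a \<longleftrightarrow> ?D (?U a) > 0"
    using Vsub_vs_shock_gap(1)[OF a(1) k(1) b k(2) b']
      Vsub_vs_shock_gap(2)[OF _ k(1) b k(2) b', of R] a by simp_all
  show ?thesis unfolding ends
  proof
    assume "\<exists>s. a < s \<and> s < R \<and> Hsup \<gamma> M q c k s = Hsub \<gamma> M q c k' s"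
    then obtain s where s: "a < s" "s < R" "?D (?U s) = 0" using gap by auto
    have "?D (?U s) < ?D (?U a)" "?D (?U R) < ?D (?U s)"
      using s(1,2) U[of a] U[of s] U[of R] mono[of a s] mono[of s R]
      by (intro shock_gap_strict_antimono; simp)+
    then show "?D (?U R) < 0 \<and> 0 < ?D (?U a)" using s by simp
  next
    assume D: "?D (?U R) < 0 \<and> 0 < ?D (?U a)"
    have "continuous_on {?U a..?U R} ?D"
    proof (rule DERIV_atLeastAtMost_imp_continuous_on)
      fix x assume "?U a \<le> x" "x \<le> ?U R"
      then have "c < x" "x < q" using U(1)[of a] U(2)[of R] a by simp_all
      then show "\<exists>d. (?D has_real_derivative d) (at x)" using shock_gap_deriv by blast
    qed
    then obtain u where u: "?U a \<le> u" "u \<le> ?U R" "?D u = 0"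
      using IVT2'[of ?D "?U R" 0 "?U a"] D mono[of a R] a by auto
    have "u \<noteq> ?U a" "u \<noteq> ?U R" using u D by auto
    with u have u': "?U a < u" "u < ?U R" by simp_all
    then have uc: "c < u" "u < q" using U[of a] U[of R] a by simp_all
    define s where "s = exp (log_radius k u)"
    have s: "0 < s" "ln s = log_radius k u" by (simp_all add: s_def)
    have "ln a < ln s" "ln s < ln R"
      using log_radius_strict_mono[of "?U a" u k] log_radius_strict_mono[of u "?U R" k]
        U[of a] U[of R] u' uc s a by simp_all
    then have as: "a < s" "s < R"
      using a s(1) ln_less_cancel_iff[of a s] ln_less_cancel_iff[of s R] by simp_all
    have "?U s = u" using Vsup_eqI uc k(1) s by blast
    then have "Hsup \<gamma> M q c k s = Hsub \<gamma> M q c k' s" using gap[of s] as u by simp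
    then show "\<exists>s. a < s \<and> s < R \<and> Hsup \<gamma> M q c k s = Hsub \<gamma> M q c k' s" using as by blast
  qed
qed

section \<open>Euler equations and jump conditions\<close>

text \<open>
  The factor \<open>(r V / M) powr (\<gamma> - 1)\<close> in the entropy coefficient cancels \<open>\<rho> powr (\<gamma> - 1)\<close>, which makes
  \<open>p / \<rho>\<close> a quadratic in \<open>V\<close>; this is Bernoulli's law, and the sonic relation turns the momentum flux
  into \<open>H / r\<close>.
\<close>

lemma flow_quantities:
  assumes r: "r > 0" and V: "0 < V" "V < q" and k: "k > 0" "ln r = log_radius k V"
    and flow: "v r = - V" "\<rho> r = M / (r * V)" "p r = k * \<rho> r powr \<gamma>"
  shows "\<rho> r * v r = - M / r"
    and "p r = M * (\<gamma> - 1) / (2 * \<gamma>) * (q\<^sup>2 - V\<^sup>2) / (r * V)"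
    and "\<rho> r * (v r)\<^sup>2 + p r = M * (\<gamma> + 1) / (2 * \<gamma>) * (c\<^sup>2 / V + V) / r"
    and "(v r)\<^sup>2 / 2 + iota \<gamma> \<rho> p r = q\<^sup>2 / 2"
proof -
  have k_eq: "k = entropy_coeff \<gamma> M q r V" using entropy_coeff_eq_iff[OF V k(1) r] k(2) by simp
  have rho: "\<rho> r > 0" using r V M_pos flow by simp
  have "(r * V / M) powr (\<gamma> - 1) * \<rho> r powr (\<gamma> - 1) = (r * V / M * \<rho> r) powr (\<gamma> - 1)"
    by (rule powr_mult[symmetric])
  also have "r * V / M * \<rho> r = 1" using r V M_pos flow by simp
  finally have one: "(r * V / M) powr (\<gamma> - 1) * \<rho> r powr (\<gamma> - 1) = 1" by simp
  have "\<rho> r powr \<gamma> = \<rho> r * \<rho> r powr (\<gamma> - 1)"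
    using rho by (simp add: powr_diff)
  then have "p r = (\<gamma> - 1) / (2 * \<gamma>) * (q\<^sup>2 - V\<^sup>2) * \<rho> r *
      ((r * V / M) powr (\<gamma> - 1) * \<rho> r powr (\<gamma> - 1))"
    unfolding flow(3) k_eq entropy_coeff_def by simp
  then have p: "p r = (\<gamma> - 1) / (2 * \<gamma>) * (q\<^sup>2 - V\<^sup>2) * \<rho> r" unfolding one by simp
  show "\<rho> r * v r = - M / r" using flow r V by simp
  show "p r = M * (\<gamma> - 1) / (2 * \<gamma>) * (q\<^sup>2 - V\<^sup>2) / (r * V)"
    unfolding p flow(2) by simp
  show "(v r)\<^sup>2 / 2 + iota \<gamma> \<rho> p r = q\<^sup>2 / 2"
    unfolding iota_def p flow(1) using gamma rho by (simp add: field_simps)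
  have "\<rho> r * (v r)\<^sup>2 + p r = M / (2 * \<gamma> * r * V) * (2 * \<gamma> * V\<^sup>2 + ((\<gamma> - 1) * q\<^sup>2 - (\<gamma> - 1) * V\<^sup>2))"
    unfolding p flow(1,2) using gamma r V by (simp add: field_simps)
  also have "\<dots> = M * (\<gamma> + 1) / (2 * \<gamma>) * (c\<^sup>2 / V + V) / r"
    unfolding bernoulli_sonic using gamma r V by (simp add: field_simps power2_eq_square)
  finally show "\<rho> r * (v r)\<^sup>2 + p r = M * (\<gamma> + 1) / (2 * \<gamma>) * (c\<^sup>2 / V + V) / r" .
qed

text \<open>
  Mass and energy fluxes are constants. In the momentum equation the factor \<open>V\<^sup>2 - c\<^sup>2\<close> of
  \<open>d/dV (c\<^sup>2 / V + V)\<close> cancels the singular denominator of the branch derivative, and what is left is \<open>p\<close>.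
\<close>

lemma radial_Euler_on_branch:
  assumes S: "\<And>r. r \<in> S \<Longrightarrow> r > 0" and k: "k > 0"
    and V: "\<And>r. r \<in> S \<Longrightarrow> 0 < V r" "\<And>r. r \<in> S \<Longrightarrow> V r < q" "\<And>r. r \<in> S \<Longrightarrow> V r \<noteq> c"
    and branch: "\<And>r. r \<in> S \<Longrightarrow> ln r = log_radius k (V r)"
    and deriv: "\<And>r. r \<in> S \<Longrightarrow> (V has_real_derivative
      (\<gamma> - 1) * V r * (q\<^sup>2 - (V r)\<^sup>2) / ((\<gamma> + 1) * ((V r)\<^sup>2 - c\<^sup>2) * r)) (at r)"
    and flow: "\<And>r. r \<in> S \<Longrightarrow> v r = - V r" "\<And>r. r \<in> S \<Longrightarrow> \<rho> r = M / (r * V r)"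
      "\<And>r. r \<in> S \<Longrightarrow> p r = k * \<rho> r powr \<gamma>"
  shows "radial_Euler_on S \<gamma> v \<rho> p"
  unfolding radial_Euler_on_def
proof (intro ballI conjI)
  have Q: "x * \<rho> x * v x = - M"
    "p x = M * (\<gamma> - 1) / (2 * \<gamma>) * (q\<^sup>2 - (V x)\<^sup>2) / (x * V x)"
    "x * \<rho> x * (v x)\<^sup>2 + x * p x = M * (\<gamma> + 1) / (2 * \<gamma>) * (c\<^sup>2 / V x + V x)"
    "(v x)\<^sup>2 / 2 + iota \<gamma> \<rho> p x = q\<^sup>2 / 2" if "x \<in> S" for x
  proof -
    note Q = flow_quantities[where v = v and \<rho> = \<rho> and p = p, OF S[OF that] V(1)[OF that]
      V(2)[OF that] k branch[OF that] flow(1)[OF that] flow(2)[OF that] flow(3)[OF that]]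
    show "x * \<rho> x * v x = - M" using Q(1) S[OF that] by (simp add: mult.assoc)
    have "x * \<rho> x * (v x)\<^sup>2 + x * p x = x * (\<rho> x * (v x)\<^sup>2 + p x)"
      by (simp add: algebra_simps)
    then show "x * \<rho> x * (v x)\<^sup>2 + x * p x = M * (\<gamma> + 1) / (2 * \<gamma>) * (c\<^sup>2 / V x + V x)"
      unfolding Q(3) using S[OF that] by simp
    show "p x = M * (\<gamma> - 1) / (2 * \<gamma>) * (q\<^sup>2 - (V x)\<^sup>2) / (x * V x)"
      "(v x)\<^sup>2 / 2 + iota \<gamma> \<rho> p x = q\<^sup>2 / 2"
      by (fact Q)+
  qed
  fix r assume rS: "r \<in> S"
  show "((\<lambda>r. r * \<rho> r * v r) has_real_derivative 0) (at r within S)"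
  proof (rule has_field_derivative_transform_within[OF _ zero_less_one rS])
    show "((\<lambda>_. - M) has_real_derivative 0) (at r within S)" by simp
  qed (simp add: Q(1))
  show "((\<lambda>r. r * \<rho> r * v r * ((v r)\<^sup>2 / 2 + iota \<gamma> \<rho> p r)) has_real_derivative 0)
      (at r within S)"
  proof (rule has_field_derivative_transform_within[OF _ zero_less_one rS])
    show "((\<lambda>_. - M * (q\<^sup>2 / 2)) has_real_derivative 0) (at r within S)" by simp
  qed (simp add: Q(1,4))
  show "((\<lambda>r. r * \<rho> r * (v r)\<^sup>2 + r * p r) has_real_derivative p r) (at r within S)"
  proof (rule has_field_derivative_transform_within[OF _ zero_less_one rS])
    let ?V' = "(\<gamma> - 1) * V r * (q\<^sup>2 - (V r)\<^sup>2) / ((\<gamma> + 1) * ((V r)\<^sup>2 - c\<^sup>2) * r)"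
    have V0: "V r > 0" "r > 0" using V S rS by auto
    have nz: "(V r)\<^sup>2 - c\<^sup>2 \<noteq> 0" using V(3)[OF rS] V0 c_pos by (simp add: power2_eq_iff)
    have "((\<lambda>r. c\<^sup>2 / V r + V r) has_real_derivative
        (0 * V r - c\<^sup>2 * ?V') / (V r * V r) + ?V') (at r)"
      using V0 by (intro DERIV_add DERIV_divide DERIV_const deriv[OF rS]) simp
    then have "((\<lambda>r. c\<^sup>2 / V r + V r) has_real_derivative
        - c\<^sup>2 * ?V' / (V r)\<^sup>2 + ?V') (at r)"
      by (simp only: power2_eq_square mult_zero_left diff_0 mult_minus_left)
    from DERIV_cmult[OF this, of "M * (\<gamma> + 1) / (2 * \<gamma>)"]
    have "((\<lambda>r. M * (\<gamma> + 1) / (2 * \<gamma>) * (c\<^sup>2 / V r + V r)) has_real_derivative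
        M * (\<gamma> + 1) / (2 * \<gamma>) * (- c\<^sup>2 * ?V' / (V r)\<^sup>2 + ?V')) (at r)" .
    moreover have "M * (\<gamma> + 1) / (2 * \<gamma>) * (- c\<^sup>2 * ?V' / (V r)\<^sup>2 + ?V') = p r"
    proof -
      have "- c\<^sup>2 * d / (V r)\<^sup>2 + d = d * (((V r)\<^sup>2 - c\<^sup>2) / (V r)\<^sup>2)" for d
        using V0 by (simp add: field_simps)
      then have "- c\<^sup>2 * ?V' / (V r)\<^sup>2 + ?V' = ?V' * (((V r)\<^sup>2 - c\<^sup>2) / (V r)\<^sup>2)" .
      also have "\<dots> = (\<gamma> - 1) * (q\<^sup>2 - (V r)\<^sup>2) / ((\<gamma> + 1) * r * V r)"
        using nz V0 gamma by (simp add: power2_eq_square)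
      finally have slope: "- c\<^sup>2 * ?V' / (V r)\<^sup>2 + ?V'
        = (\<gamma> - 1) * (q\<^sup>2 - (V r)\<^sup>2) / ((\<gamma> + 1) * r * V r)" .
      show ?thesis unfolding slope Q(2)[OF rS] using gamma V0 by (simp add: divide_simps)
    qed
    ultimately show "((\<lambda>r. M * (\<gamma> + 1) / (2 * \<gamma>) * (c\<^sup>2 / V r + V r)) has_real_derivative p r)
        (at r within S)" by (simp only: has_field_derivative_at_within)
  qed (simp add: Q(3))
qed

text \<open>
  The branch extends continuously through the shock radius although the flow does not, and the
  one-sided limits of the fluxes are their values on the extended branch.
\<close>

lemma flux_limits_branch:
  assumes F: "F = at_left s \<or> F = at_right s" and s: "s > 0" and k: "k > 0"
    and cont: "isCont V s" and Vs: "V s > 0"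
    and ev: "\<forall>\<^sub>F r in F. r > 0 \<and> 0 < V r \<and> V r < q \<and> ln r = log_radius k (V r) \<and>
      v r = - V r \<and> \<rho> r = M / (r * V r) \<and> p r = k * \<rho> r powr \<gamma>"
  shows "((\<lambda>r. \<rho> r * v r) \<longlongrightarrow> - M / s) F"
    and "((\<lambda>r. \<rho> r * (v r)\<^sup>2 + p r) \<longlongrightarrow> M * (\<gamma> + 1) / (2 * \<gamma>) * (c\<^sup>2 / V s + V s) / s) F"
    and "((\<lambda>r. (v r)\<^sup>2 / 2 + iota \<gamma> \<rho> p r) \<longlongrightarrow> q\<^sup>2 / 2) F"
proof -
  have le: "F \<le> at s" using F at_le[of _ UNIV s] by auto
  have id: "((\<lambda>r. r) \<longlongrightarrow> s) F" by (rule filterlim_mono[OF _ order_refl le]) (rule tendsto_ident_at)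
  have V: "(V \<longlongrightarrow> V s) F" using cont le by (auto simp: isCont_def intro: filterlim_mono)
  have Q: "\<forall>\<^sub>F r in F. \<rho> r * v r = - M / r \<and>
      \<rho> r * (v r)\<^sup>2 + p r = M * (\<gamma> + 1) / (2 * \<gamma>) * (c\<^sup>2 / V r + V r) / r \<and>
      (v r)\<^sup>2 / 2 + iota \<gamma> \<rho> p r = q\<^sup>2 / 2"
    using ev
  proof eventually_elim
    case (elim r)
    then show ?case using flow_quantities[of r "V r" k v \<rho> p] k by blast
  qed
  have "((\<lambda>r. - M / r) \<longlongrightarrow> - M / s) F" using s by (intro tendsto_intros id) simp
  then show "((\<lambda>r. \<rho> r * v r) \<longlongrightarrow> - M / s) F"
    by (rule Lim_transform_eventually) (use Q in \<open>eventually_elim, simp\<close>)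
  have "((\<lambda>r. M * (\<gamma> + 1) / (2 * \<gamma>) * (c\<^sup>2 / V r + V r) / r)
      \<longlongrightarrow> M * (\<gamma> + 1) / (2 * \<gamma>) * (c\<^sup>2 / V s + V s) / s) F"
    using s Vs by (intro tendsto_intros id V) simp_all
  then show "((\<lambda>r. \<rho> r * (v r)\<^sup>2 + p r)
      \<longlongrightarrow> M * (\<gamma> + 1) / (2 * \<gamma>) * (c\<^sup>2 / V s + V s) / s) F"
    by (rule Lim_transform_eventually) (use Q in \<open>eventually_elim, simp\<close>)
  show "((\<lambda>r. (v r)\<^sup>2 / 2 + iota \<gamma> \<rho> p r) \<longlongrightarrow> q\<^sup>2 / 2) F"
    by (rule tendsto_eventually) (use Q in \<open>eventually_elim, simp\<close>)
qed

theorem transonic_flow: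
  assumes a: "0 < a" "a < s" "s < R" and k: "k > 0" "k' > 0"
    and kb: "k < 1 / \<gamma> * (a / M) powr (\<gamma> - 1) * c powr (\<gamma> + 1)"
    and kb': "k' < 1 / \<gamma> * (a / M) powr (\<gamma> - 1) * c powr (\<gamma> + 1)"
    and cross: "Hsup \<gamma> M q c k s = Hsub \<gamma> M q c k' s"
    and sup: "\<And>r. r \<in> {s<..R} \<Longrightarrow> v r = - Vsup \<gamma> M q c k r"
      "\<And>r. r \<in> {s<..R} \<Longrightarrow> \<rho> r = M / (r * Vsup \<gamma> M q c k r)"
      "\<And>r. r \<in> {s<..R} \<Longrightarrow> p r = k * \<rho> r powr \<gamma>"
    and sub: "\<And>r. r \<in> {a..<s} \<Longrightarrow> v r = - Vsub \<gamma> M q c k' r"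
      "\<And>r. r \<in> {a..<s} \<Longrightarrow> \<rho> r = M / (r * Vsub \<gamma> M q c k' r)"
      "\<And>r. r \<in> {a..<s} \<Longrightarrow> p r = k' * \<rho> r powr \<gamma>"
  shows "radial_Euler_on {a..<s} \<gamma> v \<rho> p"
    and "radial_Euler_on {s<..R} \<gamma> v \<rho> p"
    and "Rankine_Hugoniot_at s \<gamma> v \<rho> p"
proof -
  let ?U = "Vsup \<gamma> M q c k" and ?W = "Vsub \<gamma> M q c k'"
  have b: "k < 1 / \<gamma> * (r / M) powr (\<gamma> - 1) * c powr (\<gamma> + 1)"
    and b': "k' < 1 / \<gamma> * (r / M) powr (\<gamma> - 1) * c powr (\<gamma> + 1)" if "a \<le> r" for r
    using subsonic_bound_mono[OF a(1) that] kb kb' by blast+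
  have U: "c < ?U r" "?U r < q" "ln r = log_radius k (?U r)" if "a \<le> r" for r
    using Vsup_branch[OF _ k(1) b[OF that]] that a by simp_all
  have W: "0 < ?W r" "?W r < c" "ln r = log_radius k' (?W r)" if "a \<le> r" for r
    using Vsub_branch[OF _ k(2) b'[OF that]] that a by simp_all
  have U': "0 < ?U r" "?U r \<noteq> c" and W': "?W r < q" "?W r \<noteq> c" if "a \<le> r" for r
    using U[OF that] W[OF that] c_pos c_less_q by auto
  note dU = Vsup_deriv[OF _ k(1) b] and dW = Vsub_deriv[OF _ k(2) b']
  show "radial_Euler_on {a..<s} \<gamma> v \<rho> p"
    by (rule radial_Euler_on_branch[where V = ?W, OF _ k(2)])
       (use a W W' sub dW in \<open>auto simp del: times_divide_eq_right\<close>)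
  show "radial_Euler_on {s<..R} \<gamma> v \<rho> p"
    by (rule radial_Euler_on_branch[where V = ?U, OF _ k(1)])
       (use a U U' sup dU in \<open>auto simp del: times_divide_eq_right\<close>)
  have s: "0 < s" "a \<le> s" using a by simp_all
  have left: "\<forall>\<^sub>F r in at_left s. r > 0 \<and> 0 < ?W r \<and> ?W r < q \<and> ln r = log_radius k' (?W r) \<and>
      v r = - ?W r \<and> \<rho> r = M / (r * ?W r) \<and> p r = k' * \<rho> r powr \<gamma>"
    using eventually_at_left_real[OF a(2)]
    by eventually_elim (use a W W' sub in auto)
  have right: "\<forall>\<^sub>F r in at_right s. r > 0 \<and> 0 < ?U r \<and> ?U r < q \<and> ln r = log_radius k (?U r) \<and>
      v r = - ?U r \<and> \<rho> r = M / (r * ?U r) \<and> p r = k * \<rho> r powr \<gamma>"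
    using eventually_at_right_real[OF a(3)]
    by eventually_elim (use a U U' sup in auto)
  note L = flux_limits_branch[OF disjI1[OF refl] s(1) k(2) DERIV_isCont[OF dW[OF s]] W(1)[OF s(2)] left]
  note R = flux_limits_branch[OF disjI2[OF refl] s(1) k(1) DERIV_isCont[OF dU[OF s]] U'(1)[OF s(2)] right]
  have H: "M * (\<gamma> + 1) / (2 * \<gamma>) * (c\<^sup>2 / ?W s + ?W s) / s
      = M * (\<gamma> + 1) / (2 * \<gamma>) * (c\<^sup>2 / ?U s + ?U s) / s"
    using arg_cong[OF cross[symmetric], of "\<lambda>x. x / s"] unfolding Hsup_def Hsub_def .
  show "Rankine_Hugoniot_at s \<gamma> v \<rho> p"
    unfolding Rankine_Hugoniot_at_def continuous_across_def
    by (intro conjI exI; (rule L(1) L(2) L(3) R(1) R(3) R(2)[folded H]))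
qed

end

section \<open>Transonic shock in the radial model problem\<close>

theorem mainTheorem3:
  fixes \<gamma> a R v\<^sub>0 v\<^sub>a \<rho>\<^sub>0 k\<^sub>0 M\<^sub>0 q\<^sub>0 c k\<^sub>a :: real
  assumes "\<gamma> > 1" and "0 < a" and "a < R"
    and "v\<^sub>0 > 0" and "v\<^sub>a > 0" and "\<rho>\<^sub>0 > 0" and "k\<^sub>0 > 0"
    and M0: "M\<^sub>0 = \<rho>\<^sub>0 * v\<^sub>0 * R"
    and q0: "q\<^sub>0 > 0" "q\<^sub>0\<^sup>2 = v\<^sub>0\<^sup>2 + 2 * \<gamma> / (\<gamma> - 1) * k\<^sub>0 * \<rho>\<^sub>0 powr (\<gamma> - 1)"
    and c: "c > 0" "c\<^sup>2 = (\<gamma> - 1) / (\<gamma> + 1) * q\<^sub>0\<^sup>2"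
    and ka: "k\<^sub>a = (\<gamma> - 1) / (2 * \<gamma>) * (a * v\<^sub>a / M\<^sub>0) powr (\<gamma> - 1) * (q\<^sub>0\<^sup>2 - v\<^sub>a\<^sup>2)"
    and "\<gamma> * k\<^sub>0 * \<rho>\<^sub>0 powr (\<gamma> - 1) < v\<^sub>0\<^sup>2"
    and "v\<^sub>a < c"
    and "k\<^sub>0 < k\<^sub>a"
    and "k\<^sub>a < 1 / \<gamma> * (a / M\<^sub>0) powr (\<gamma> - 1) * c powr (\<gamma> + 1)"
  shows
    "((\<exists>r\<^sub>s. a < r\<^sub>s \<and> r\<^sub>s < R \<and> Hsup \<gamma> M\<^sub>0 q\<^sub>0 c k\<^sub>0 r\<^sub>s = Hsub \<gamma> M\<^sub>0 q\<^sub>0 c k\<^sub>a r\<^sub>s)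
      \<longleftrightarrow>
      c\<^sup>2 > Vsub \<gamma> M\<^sub>0 q\<^sub>0 c k\<^sub>a R * Vsup \<gamma> M\<^sub>0 q\<^sub>0 c k\<^sub>0 R \<and>
      c\<^sup>2 < Vsup \<gamma> M\<^sub>0 q\<^sub>0 c k\<^sub>0 a * Vsub \<gamma> M\<^sub>0 q\<^sub>0 c k\<^sub>a a)
     \<and>
     (\<forall>r\<^sub>s (v :: real \<Rightarrow> real) (\<rho> :: real \<Rightarrow> real) (p :: real \<Rightarrow> real).
        a < r\<^sub>s \<and> r\<^sub>s < R \<and> Hsup \<gamma> M\<^sub>0 q\<^sub>0 c k\<^sub>0 r\<^sub>s = Hsub \<gamma> M\<^sub>0 q\<^sub>0 c k\<^sub>a r\<^sub>s \<and>
        (\<forall>r\<in>{r\<^sub>s<..R}.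
           v r = - Vsup \<gamma> M\<^sub>0 q\<^sub>0 c k\<^sub>0 r \<and>
           \<rho> r = M\<^sub>0 / (r * Vsup \<gamma> M\<^sub>0 q\<^sub>0 c k\<^sub>0 r) \<and>
           p r = k\<^sub>0 * \<rho> r powr \<gamma>) \<and>
        (\<forall>r\<in>{a..<r\<^sub>s}.
           v r = - Vsub \<gamma> M\<^sub>0 q\<^sub>0 c k\<^sub>a r \<and>
           \<rho> r = M\<^sub>0 / (r * Vsub \<gamma> M\<^sub>0 q\<^sub>0 c k\<^sub>a r) \<and>
           p r = k\<^sub>a * \<rho> r powr \<gamma>)
        \<longrightarrow>
        radial_Euler_on {a..<r\<^sub>s} \<gamma> v \<rho> p \<and>
        radial_Euler_on {r\<^sub>s<..R} \<gamma> v \<rho> p \<and>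
        Rankine_Hugoniot_at r\<^sub>s \<gamma> v \<rho> p)"
proof -
  have "M\<^sub>0 > 0" using M0 assms(2-6) by simp
  then interpret radial_gas \<gamma> M\<^sub>0 q\<^sub>0 c
    using assms by unfold_locales auto
  have k: "k\<^sub>0 > 0" "k\<^sub>a > 0" "k\<^sub>0 < 1 / \<gamma> * (a / M\<^sub>0) powr (\<gamma> - 1) * c powr (\<gamma> + 1)"
    "k\<^sub>a < 1 / \<gamma> * (a / M\<^sub>0) powr (\<gamma> - 1) * c powr (\<gamma> + 1)"
    using assms by linarith+
  show ?thesis
  proof (intro conjI allI impI, goal_cases)
    case 1
    show ?case using crossing_iff[OF assms(2,3) k] by (simp only: mult.commute)
  next
    case (2 r\<^sub>s v \<rho> p)
    then show ?case
      by (intro transonic_flow(1)[OF assms(2) _ _ k, of r\<^sub>s R]) blast+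
  next
    case (3 r\<^sub>s v \<rho> p)
    then show ?case
      by (intro transonic_flow(2)[OF assms(2) _ _ k, of r\<^sub>s R]) blast+
  next
    case (4 r\<^sub>s v \<rho> p)
    then show ?case
      by (intro transonic_flow(3)[OF assms(2) _ _ k, of r\<^sub>s R]) blast+
  qed
qed

end
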